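(* Let $\widetilde H$, $H$ and $\pi$ be as in the context. The set of divisor-closed submonoids of $\widetilde H$ is equal to $$\{\pi(S)\mid S \text{ is a divisor-closed submonoid of } H \text{ and } \pi^{-1}(\pi(S))\cap H=S\}.$$
   Context: $\mathbb{N}$ denotes the nonnegative integers. Monoids are commutative, written additively, and cancellative; submonoids contain $0$. A submonoid $S$ of a monoid $T$ is divisor-closed if $b,c\in T$ and $b+c\in S$ imply $b,c\in S$. Setting: $M$ is a subgroup of $\mathbb{Z}^p$, $\sim_M$ is the congruence on $\mathbb{N}^p$ with $a\sim_M b$ iff $a-b\in M$, and the monoid $\mathbb{N}^p/\sim_M$ is reduced (it has no nontrivial units; equivalently $M\cap\mathbb{N}^p=\{0\}$). The group $M$ is given by defining equations: $M$ is the set of $x\in\mathbb{Z}^p$ such that $\sum_j a_{ij}x_j\equiv 0 \pmod{d_i}$ for $1\le i\le r$ and $\sum_j a_{ij}x_j=0$ for $r+1\le i\le r+k$, where the $d_i$ are positive integers. Since the monoid is reduced, the integer matrix $A=(a_{ij})$ (of size $(r+k)\times p$) can be and is chosen with all entries in $\mathbb{N}$, with $a_{ij}\in\{0,\dots,d_i-1\}$ for $i\le r$. Put $a_{*j}=(a_{1j},\dots,a_{(r+k)j})\in\mathbb{N}^{r+k}$ and $\widetilde a_{*j}=([a_{1j}]_{d_1},\dots,[a_{rj}]_{d_r},a_{(r+1)j},\dots,a_{(r+k)j})\in\mathbb{Z}_{d_1}\times\dots\times\mathbb{Z}_{d_r}\times\mathbb{Z}^k$ for $1\le j\le p$, where $[a]_d$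 is the class of $a$ in $\mathbb{Z}_d=\mathbb{Z}/d\mathbb{Z}$. The monoid $\mathbb{N}^p/\sim_M$ is isomorphic to, and is identified with, the submonoid $\widetilde H$ of $\mathbb{Z}_{d_1}\times\dots\times\mathbb{Z}_{d_r}\times\mathbb{Z}^k$ generated by $\widetilde a_{*1},\dots,\widetilde a_{*p}$. $H$ is the submonoid of $\mathbb{N}^{r+k}$ generated by $a_{*1},\dots,a_{*p}$. The map $\pi:\mathbb{N}^{r+k}\to\mathbb{Z}_{d_1}\times\dots\times\mathbb{Z}_{d_r}\times\mathbb{N}^k$ is the monoid morphism reducing the $i$-th coordinate modulo $d_i$ for $i\le r$ and leaving the last $k$ coordinates unchanged; so $\pi(a_{*j})=\widetilde a_{*j}$ and $\pi(H)=\widetilde H$. *)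

theory Defs
  imports "HOL-Algebra.Product_Groups" "HOL-Number_Theory.Cong"
begin

definition nat_monoid :: "nat monoid" where
  "nat_monoid = \<lparr>carrier = UNIV, monoid.mult = (+), one = 0\<rparr>"

text \<open>Vectors are extensional functions on \<open>{1..n}\<close>; the product construction of the library
  only uses the monoid operations of its factors, so it also yields the monoid \<open>\<nat>\<^sup>n\<close>.\<close>

definition nat_vec :: "nat \<Rightarrow> (nat \<Rightarrow> nat) monoid" where
  "nat_vec n = product_group {1..n} (\<lambda>_. nat_monoid)"

definition int_vec :: "nat \<Rightarrow> (nat \<Rightarrow> int) monoid" where
  "int_vec n = product_group {1..n} (\<lambda>_. integer_group)"

text \<open>The group \<open>\<int>\<^bsub>d 1\<^esub> \<times> \<dots> \<times> \<int>\<^bsub>d r\<^esub> \<times> \<int>\<^sup>k\<close>; a residue class modulo \<open>d i\<close> is represented by its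
  least nonnegative element.\<close>

definition mixed_group :: "nat \<Rightarrow> nat \<Rightarrow> (nat \<Rightarrow> nat) \<Rightarrow> (nat \<Rightarrow> int) monoid" where
  "mixed_group r k d =
     product_group {1..r + k} (\<lambda>i. if i \<le> r then integer_mod_group (d i) else integer_group)"

definition divisor_closed_submonoid :: "'a set \<Rightarrow> ('a, 'b) monoid_scheme \<Rightarrow> bool" where
  "divisor_closed_submonoid S T \<longleftrightarrow>
     submonoid S T \<and>
     (\<forall>b \<in> carrier T. \<forall>c \<in> carrier T. b \<otimes>\<^bsub>T\<^esub> c \<in> S \<longrightarrow> b \<in> S \<and> c \<in> S)"

definition generated_submonoid :: "('a, 'b) monoid_scheme \<Rightarrow> 'a set \<Rightarrow> ('a, 'b) monoid_scheme" where
  "generated_submonoid T X = T\<lparr>carrier := \<Inter>{S. submonoid S T \<and> X \<subseteq> S}\<rparr>"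

definition reduced_monoid :: "('a, 'b) monoid_scheme \<Rightarrow> bool" where
  "reduced_monoid T \<longleftrightarrow> Units T = {\<one>\<^bsub>T\<^esub>}"

definition lattice_cong :: "nat \<Rightarrow> (nat \<Rightarrow> int) set \<Rightarrow> ((nat \<Rightarrow> nat) \<times> (nat \<Rightarrow> nat)) set" where
  "lattice_cong p M =
     {(a, b). a \<in> carrier (nat_vec p) \<and> b \<in> carrier (nat_vec p) \<and>
              (\<lambda>j\<in>{1..p}. int (a j) - int (b j)) \<in> M}"

definition quotient_monoid :: "('a, 'b) monoid_scheme \<Rightarrow> ('a \<times> 'a) set \<Rightarrow> 'a set monoid" where
  "quotient_monoid T R =
     \<lparr>carrier = carrier T // R,
      monoid.mult = (\<lambda>A B. \<Union>a\<in>A. \<Union>b\<in>B. R `` {a \<otimes>\<^bsub>T\<^esub> b}),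
      one = R `` {\<one>\<^bsub>T\<^esub>}\<rparr>"

definition defined_by_equations ::
    "nat \<Rightarrow> nat \<Rightarrow> nat \<Rightarrow> (nat \<Rightarrow> nat) \<Rightarrow> (nat \<Rightarrow> nat \<Rightarrow> nat) \<Rightarrow> (nat \<Rightarrow> int) set \<Rightarrow> bool" where
  "defined_by_equations p r k d a M \<longleftrightarrow>
     M = {x \<in> carrier (int_vec p).
            (\<forall>i\<in>{1..r}. [(\<Sum>j = 1..p. int (a i j) * x j) = 0] (mod int (d i))) \<and>
            (\<forall>i\<in>{r + 1..r + k}. (\<Sum>j = 1..p. int (a i j) * x j) = 0)}"

definition column :: "nat \<Rightarrow> nat \<Rightarrow> (nat \<Rightarrow> nat \<Rightarrow> nat) \<Rightarrow> nat \<Rightarrow> (nat \<Rightarrow> nat)" where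
  "column r k a j = (\<lambda>i\<in>{1..r + k}. a i j)"

definition mod_column ::
    "nat \<Rightarrow> nat \<Rightarrow> (nat \<Rightarrow> nat) \<Rightarrow> (nat \<Rightarrow> nat \<Rightarrow> nat) \<Rightarrow> nat \<Rightarrow> (nat \<Rightarrow> int)" where
  "mod_column r k d a j =
     (\<lambda>i\<in>{1..r + k}. if i \<le> r then int (a i j) mod int (d i) else int (a i j))"

definition H_monoid :: "nat \<Rightarrow> nat \<Rightarrow> nat \<Rightarrow> (nat \<Rightarrow> nat \<Rightarrow> nat) \<Rightarrow> (nat \<Rightarrow> nat) monoid" where
  "H_monoid p r k a = generated_submonoid (nat_vec (r + k)) (column r k a ` {1..p})"

definition H_tilde_monoid ::
    "nat \<Rightarrow> nat \<Rightarrow> nat \<Rightarrow> (nat \<Rightarrow> nat) \<Rightarrow> (nat \<Rightarrow> nat \<Rightarrow> nat) \<Rightarrow> (nat \<Rightarrow> int) monoid" where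
  "H_tilde_monoid p r k d a =
     generated_submonoid (mixed_group r k d) (mod_column r k d a ` {1..p})"

text \<open>The codomain \<open>\<int>\<^bsub>d 1\<^esub> \<times> \<dots> \<times> \<int>\<^bsub>d r\<^esub> \<times> \<nat>\<^sup>k\<close> of the reduction map is regarded as a submonoid of
  \<^const>\<open>mixed_group\<close>.\<close>

definition reduction_map :: "nat \<Rightarrow> nat \<Rightarrow> (nat \<Rightarrow> nat) \<Rightarrow> (nat \<Rightarrow> nat) \<Rightarrow> (nat \<Rightarrow> int)" where
  "reduction_map r k d x =
     (\<lambda>i\<in>{1..r + k}. if i \<le> r then int (x i) mod int (d i) else int (x i))"

end

theory Submission
  imports Defs
begin

text \<open>The statement holds for every surjective homomorphism \<open>h\<close> of monoids. The preimage of a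
  divisor-closed submonoid is a divisor-closed submonoid, it is the full preimage of its own
  image, and surjectivity recovers the original from it. Conversely, let \<open>S\<close> be divisor-closed
  and equal to the preimage of its image. If a sum \<open>h x + h y = h (x + y)\<close> lies in \<open>h ` S\<close>,
  then \<open>x + y\<close> itself lies in \<open>S\<close>, hence so do \<open>x\<close> and \<open>y\<close>; thus \<open>h ` S\<close> is divisor-closed.
  This is \<open>divisor_closed_submonoids_of_image\<close>.

  It remains to see that reduction restricts to a surjective homomorphism between the two
  monoids in question. It is a homomorphism on all vectors (\<open>reduction_map_hom\<close>), it sends
  generators to generators, and the image of a generated submonoid is generated by the images of
  the generators (\<open>image_generated_submonoid\<close>).\<close>

lemma submonoid_vimage:
  assumes "monoid T" and hom: "h \<in> hom T T'" and one: "h \<one>\<^bsub>T\<^esub> = \<one>\<^bsub>T'\<^esub>"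
    and sub: "submonoid S T'"
  shows "submonoid (h -` S \<inter> carrier T) T"
proof -
  interpret monoid T by fact
  show ?thesis
    using sub by (auto simp: submonoid_def hom_mult[OF hom] one)
qed

lemma submonoid_image:
  assumes hom: "h \<in> hom T T'" and one: "h \<one>\<^bsub>T\<^esub> = \<one>\<^bsub>T'\<^esub>"
    and sub: "submonoid S T"
  shows "submonoid (h ` S) T'"
proof
  have S: "S \<subseteq> carrier T"
    using sub by (rule submonoid.subset)
  show "h ` S \<subseteq> carrier T'"
    using S hom_in_carrier[OF hom] by blast
  show "\<one>\<^bsub>T'\<^esub> \<in> h ` S"
    using submonoid.one_closed[OF sub] one by (metis imageI)
  fix x y assume "x \<in> h ` S" "y \<in> h ` S"
  then obtain u v where uv: "u \<in> S" "v \<in> S" "x = h u" "y = h v"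
    by blast
  then have "x \<otimes>\<^bsub>T'\<^esub> y = h (u \<otimes>\<^bsub>T\<^esub> v)"
    using S hom_mult[OF hom] by (metis subsetD)
  then show "x \<otimes>\<^bsub>T'\<^esub> y \<in> h ` S"
    using submonoid.m_closed[OF sub] uv by simp
qed

lemma divisor_closed_submonoids_of_image:
  assumes T: "monoid T" and hom: "h \<in> hom T T'"
    and one: "h \<one>\<^bsub>T\<^esub> = \<one>\<^bsub>T'\<^esub>"
    and surj: "h ` carrier T = carrier T'"
  shows "{S. divisor_closed_submonoid S T'} =
         {h ` S | S. divisor_closed_submonoid S T \<and> h -` (h ` S) \<inter> carrier T = S}"
    (is "?L = ?R")
proof (intro equalityI subsetI)
  fix S' assume "S' \<in> ?L"
  then have sub: "submonoid S' T'"
    and div: "\<And>b c. b \<in> carrier T' \<Longrightarrow> c \<in> carrier T' \<Longrightarrow> b \<otimes>\<^bsub>T'\<^esub> c \<in> S' \<Longrightarrow> b \<in> S' \<and> c \<in> S'"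
    by (auto simp: divisor_closed_submonoid_def)
  define S where "S = h -` S' \<inter> carrier T"
  have "S' \<subseteq> h ` carrier T"
    using submonoid.subset[OF sub] surj by simp
  then have image: "h ` S = S'"
    unfolding S_def by blast
  have "b \<in> S \<and> c \<in> S" if "b \<in> carrier T" "c \<in> carrier T" "b \<otimes>\<^bsub>T\<^esub> c \<in> S" for b c
    using that div[of "h b" "h c"] by (simp add: S_def hom_mult[OF hom] hom_in_carrier[OF hom])
  then have "divisor_closed_submonoid S T"
    unfolding divisor_closed_submonoid_def
    using submonoid_vimage[OF T hom one sub] by (simp add: S_def)
  moreover have "h -` (h ` S) \<inter> carrier T = S"
    unfolding image by (simp add: S_def)
  ultimately show "S' \<in> ?R"
    using image by (intro CollectI exI[of _ S]) simp
next
  fix S' assume "S' \<in> ?R"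
  then obtain S where S': "S' = h ` S" and dc: "divisor_closed_submonoid S T"
    and sat: "h -` (h ` S) \<inter> carrier T = S"
    by auto
  have "b \<in> h ` S \<and> c \<in> h ` S"
    if bc: "b \<in> carrier T'" "c \<in> carrier T'" "b \<otimes>\<^bsub>T'\<^esub> c \<in> h ` S" for b c
  proof -
    obtain x y where xy: "x \<in> carrier T" "y \<in> carrier T" "b = h x" "c = h y"
      using bc(1,2) unfolding surj[symmetric] by auto
    then have "h (x \<otimes>\<^bsub>T\<^esub> y) \<in> h ` S"
      using bc(3) hom_mult[OF hom] by simp
    then have "x \<otimes>\<^bsub>T\<^esub> y \<in> h -` (h ` S) \<inter> carrier T"
      using monoid.m_closed[OF T] xy by simp
    then have "x \<otimes>\<^bsub>T\<^esub> y \<in> S"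
      unfolding sat .
    then have "x \<in> S \<and> y \<in> S"
      using dc xy by (auto simp: divisor_closed_submonoid_def)
    then show ?thesis
      using xy by simp
  qed
  moreover have "submonoid (h ` S) T'"
    using submonoid_image[OF hom one] dc by (simp add: divisor_closed_submonoid_def)
  ultimately show "S' \<in> ?L"
    by (simp add: divisor_closed_submonoid_def S')
qed

lemma submonoid_carrier: "monoid T \<Longrightarrow> submonoid (carrier T) T"
  by (simp add: submonoid_def monoid.m_closed monoid.one_closed)

text \<open>The hypotheses make the whole carrier a submonoid containing \<open>X\<close>. Otherwise the family
  that is intersected could be empty, and its intersection would be the whole type.\<close>

lemma submonoid_generated_submonoid:
  assumes "monoid T" and "X \<subseteq> carrier T"
  shows "submonoid (carrier (generated_submonoid T X)) T"
  using submonoid_carrier[OF assms(1)] assms(2)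
  unfolding generated_submonoid_def submonoid_def by auto

lemma image_generated_submonoid:
  assumes T: "monoid T" and hom: "h \<in> hom T T'" and one: "h \<one>\<^bsub>T\<^esub> = \<one>\<^bsub>T'\<^esub>"
    and X: "X \<subseteq> carrier T"
  shows "h ` carrier (generated_submonoid T X) = carrier (generated_submonoid T' (h ` X))"
proof
  show "h ` carrier (generated_submonoid T X) \<subseteq> carrier (generated_submonoid T' (h ` X))"
  proof (clarsimp simp: generated_submonoid_def)
    fix x S assume x: "\<forall>S. submonoid S T \<and> X \<subseteq> S \<longrightarrow> x \<in> S"
      and S: "submonoid S T'" "h ` X \<subseteq> S"
    have "X \<subseteq> h -` S \<inter> carrier T"
      using X S(2) by blast
    then show "h x \<in> S"
      using x submonoid_vimage[OF T hom one S(1)] by blast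
  qed
  have "submonoid (h ` carrier (generated_submonoid T X)) T'"
    using submonoid_image[OF hom one submonoid_generated_submonoid[OF T X]] .
  moreover have "h ` X \<subseteq> h ` carrier (generated_submonoid T X)"
    by (auto simp: generated_submonoid_def)
  ultimately show "carrier (generated_submonoid T' (h ` X)) \<subseteq> h ` carrier (generated_submonoid T X)"
    by (auto simp: generated_submonoid_def)
qed

lemma monoid_nat_vec: "monoid (nat_vec n)"
  by (rule monoidI) (auto simp: nat_vec_def nat_monoid_def PiE_iff extensional_def fun_eq_iff)

lemma reduction_map_hom: "reduction_map r k d \<in> hom (nat_vec (r + k)) (mixed_group r k d)"
  by (rule homI)
    (auto simp: nat_vec_def nat_monoid_def mixed_group_def reduction_map_def
      carrier_integer_mod_group mult_integer_mod_group mod_add_eq fun_eq_iff)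

lemma reduction_map_one: "reduction_map r k d \<one>\<^bsub>nat_vec (r + k)\<^esub> = \<one>\<^bsub>mixed_group r k d\<^esub>"
  by (auto simp: nat_vec_def nat_monoid_def mixed_group_def reduction_map_def fun_eq_iff)

theorem corollary23:
  fixes p r k :: nat
    and d :: "nat \<Rightarrow> nat"
    and a :: "nat \<Rightarrow> nat \<Rightarrow> nat"
    and M :: "(nat \<Rightarrow> int) set"
  assumes M_subgroup: "subgroup M (int_vec p)"
    and reduced: "reduced_monoid (quotient_monoid (nat_vec p) (lattice_cong p M))"
    and d_pos: "\<And>i. i \<in> {1..r} \<Longrightarrow> d i > 0"
    and a_less: "\<And>i j. i \<in> {1..r} \<Longrightarrow> j \<in> {1..p} \<Longrightarrow> a i j < d i"
    and M_eqns: "defined_by_equations p r k d a M"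
  shows "{S. divisor_closed_submonoid S (H_tilde_monoid p r k d a)} =
         {reduction_map r k d ` S | S.
            divisor_closed_submonoid S (H_monoid p r k a) \<and>
            reduction_map r k d -` (reduction_map r k d ` S) \<inter> carrier (H_monoid p r k a) = S}"
proof (rule divisor_closed_submonoids_of_image)
  let ?h = "reduction_map r k d" and ?X = "column r k a ` {1..p}"
  have X: "?X \<subseteq> carrier (nat_vec (r + k))"
    by (auto simp: column_def nat_vec_def nat_monoid_def)
  have gens: "?h ` ?X = mod_column r k d a ` {1..p}"
    by (force simp: image_image reduction_map_def column_def mod_column_def intro!: image_cong)
  show image: "?h ` carrier (H_monoid p r k a) = carrier (H_tilde_monoid p r k d a)"
    using image_generated_submonoid[OF monoid_nat_vec reduction_map_hom reduction_map_one X, of d]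
    unfolding H_monoid_def H_tilde_monoid_def gens .
  have sub: "submonoid (carrier (H_monoid p r k a)) (nat_vec (r + k))"
    unfolding H_monoid_def by (rule submonoid_generated_submonoid[OF monoid_nat_vec X])
  then show "monoid (H_monoid p r k a)"
    using submonoid.submonoid_is_monoid[OF sub monoid_nat_vec]
    by (simp add: H_monoid_def generated_submonoid_def)
  show "?h \<in> hom (H_monoid p r k a) (H_tilde_monoid p r k d a)"
  proof (rule homI)
    show "?h x \<in> carrier (H_tilde_monoid p r k d a)" if "x \<in> carrier (H_monoid p r k a)" for x
      using image that by blast
    show "?h (x \<otimes>\<^bsub>H_monoid p r k a\<^esub> y) = ?h x \<otimes>\<^bsub>H_tilde_monoid p r k d a\<^esub> ?h y"
      if "x \<in> carrier (H_monoid p r k a)" "y \<in> carrier (H_monoid p r k a)" for x y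
      using hom_mult[OF reduction_map_hom] that submonoid.subset[OF sub]
      by (simp add: H_monoid_def H_tilde_monoid_def generated_submonoid_def subset_eq)
  qed
  show "?h \<one>\<^bsub>H_monoid p r k a\<^esub> = \<one>\<^bsub>H_tilde_monoid p r k d a\<^esub>"
    using reduction_map_one by (simp add: H_monoid_def H_tilde_monoid_def generated_submonoid_def)
qed

end
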